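(* Let $n$ be a positive integer. The mapping $\psi$ from $G_{n+1}^{2}$ to $G_{n,d}^{2}$ given on generators by $$\psi(a_{ij})=\begin{cases} a_{ij} & \text{if } n+1\notin\{i,j\},\\ \tau_{i} & \text{if } j=n+1,\\ \tau_{j} & \text{if } i=n+1,\end{cases}$$ and extended multiplicatively to words, is well defined (that is, this assignment on generators induces a group homomorphism $G_{n+1}^2\to G_{n,d}^2$).
   Context: Convention: generators are indexed by unordered pairs, so $a_{ji}$ means $a_{ij}$. For a positive integer $m$, $G_{m}^{2}$ is the group with generators $a_{ij}$ for $\{i,j\}\subset\{1,\dots,m\}$, $i<j$, and relations: (1) $a_{ij}^{2}=1$ for all $i\neq j$; (2) $a_{ij}a_{kl}=a_{kl}a_{ij}$ for distinct $i,j,k,l$; (3) $a_{ij}a_{ik}a_{jk}=a_{jk}a_{ik}a_{ij}$ for distinct $i,j,k$. $G_{n,d}^{2}$ ($G_n^2$ with points) is the group with generators $a_{ij}$ for $\{i,j\}\subset\{1,\dots,n\}$, $i<j$, and $\tau_{i}$ for $i\in\{1,\dots,n\}$, and relations: (1) $a_{ij}^{2}=1$ for $i\neq j$; (2) $a_{ij}a_{kl}=a_{kl}a_{ij}$ for distinct $i,j,k,l$; (3) $a_{ij}a_{ik}a_{jk}=a_{jk}a_{ik}a_{ij}$ for distinct $i,j,k$; (4) $\tau_{i}^{2}=1$ for all $i$; (5) $\tau_{i}\tau_{j}=\tau_{j}\tau_{i}$ for all $i,j$; (6) $\tau_{i}\tau_{j}a_{ij}\tau_{j}\tau_{i}=a_{ij}$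 for distinct $i,j$; (7) $a_{ij}\tau_{k}=\tau_{k}a_{ij}$ for distinct $i,j,k$. *)

theory Defs
  imports "HOL-Algebra.Coset"
begin

section \<open>Groups given by generators and relations\<close>

text \<open>A word over \<open>S \<union> S\<inverse>\<close>: the letter \<open>(x, True)\<close> stands for \<open>x\<close> and \<open>(x, False)\<close> for
  its formal inverse. A pair \<open>(u, v)\<close> of words in the set \<open>R\<close> stands for the relation \<open>u = v\<close>.\<close>

type_synonym 'a word = "('a \<times> bool) list"

definition words :: "'a set \<Rightarrow> 'a word set" where
  "words S = lists (S \<times> UNIV)"

inductive_set pres_rel :: "'a set \<Rightarrow> ('a word \<times> 'a word) set \<Rightarrow> ('a word \<times> 'a word) set"
  for S R where
  refl: "w \<in> words S \<Longrightarrow> (w, w) \<in> pres_rel S R"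
| sym: "(u, v) \<in> pres_rel S R \<Longrightarrow> (v, u) \<in> pres_rel S R"
| trans: "(u, v) \<in> pres_rel S R \<Longrightarrow> (v, w) \<in> pres_rel S R \<Longrightarrow> (u, w) \<in> pres_rel S R"
| append: "(u, u') \<in> pres_rel S R \<Longrightarrow> (v, v') \<in> pres_rel S R \<Longrightarrow> (u @ v, u' @ v') \<in> pres_rel S R"
| cancel: "x \<in> S \<Longrightarrow> ([(x, b), (x, \<not> b)], []) \<in> pres_rel S R"
| rel: "(u, v) \<in> R \<Longrightarrow> u \<in> words S \<Longrightarrow> v \<in> words S \<Longrightarrow> (u, v) \<in> pres_rel S R"

definition pres_class :: "'a set \<Rightarrow> ('a word \<times> 'a word) set \<Rightarrow> 'a word \<Rightarrow> 'a word set" where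
  "pres_class S R w = pres_rel S R `` {w}"

definition pres_group :: "'a set \<Rightarrow> ('a word \<times> 'a word) set \<Rightarrow> 'a word set monoid" where
  "pres_group S R =
    \<lparr> carrier = words S // pres_rel S R,
      mult = (\<lambda>X Y. \<Union>u\<in>X. \<Union>v\<in>Y. pres_class S R (u @ v)),
      one = pres_class S R [] \<rparr>"

lemma pres_rel_words:
  assumes "(u, v) \<in> pres_rel S R"
  shows "u \<in> words S \<and> v \<in> words S"
  using assms by induction (auto simp: words_def)

lemma equiv_pres_rel: "equiv (words S) (pres_rel S R)"
proof (rule equivI)
  show "pres_rel S R \<subseteq> words S \<times> words S"
    by (auto dest: pres_rel_words)
  show "refl_on (words S) (pres_rel S R)"
    by (auto simp: refl_on_def intro: pres_rel.refl)
  show "Relation.sym (pres_rel S R)"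
    by (rule symI) (rule pres_rel.sym)
  show "Relation.trans (pres_rel S R)"
    by (rule transI) (rule pres_rel.trans)
qed

lemma pres_class_eqI: "(u, v) \<in> pres_rel S R \<Longrightarrow> pres_class S R u = pres_class S R v"
  unfolding pres_class_def by (rule equiv_class_eq[OF equiv_pres_rel])

lemma pres_class_eq_iff:
  assumes "u \<in> words S" "v \<in> words S"
  shows "pres_class S R u = pres_class S R v \<longleftrightarrow> (u, v) \<in> pres_rel S R"
  unfolding pres_class_def by (rule eq_equiv_class_iff[OF equiv_pres_rel assms])

lemma carrier_pres_group: "carrier (pres_group S R) = pres_class S R ` words S"
  by (auto simp: pres_group_def quotient_def pres_class_def)

lemma one_pres_group: "\<one>\<^bsub>pres_group S R\<^esub> = pres_class S R []"
  by (simp add: pres_group_def)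

lemma mult_pres_class:
  assumes "u \<in> words S" "v \<in> words S"
  shows "pres_class S R u \<otimes>\<^bsub>pres_group S R\<^esub> pres_class S R v = pres_class S R (u @ v)"
proof -
  have *: "pres_class S R (u' @ v') = pres_class S R (u @ v)"
    if "u' \<in> pres_class S R u" "v' \<in> pres_class S R v" for u' v'
    using that pres_class_eqI[OF pres_rel.append[of u u' S R v v']]
    by (simp add: pres_class_def)
  have "u \<in> pres_class S R u" "v \<in> pres_class S R v"
    using assms by (auto simp: pres_class_def intro: pres_rel.refl)
  then have "(\<Union>u'\<in>pres_class S R u. \<Union>v'\<in>pres_class S R v. pres_class S R (u' @ v'))
      = pres_class S R (u @ v)"
    using * by blast
  then show ?thesis
    by (simp add: pres_group_def)
qed

lemma pres_rel_left_inverse: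
  assumes "w \<in> words S"
  shows "\<exists>w' \<in> words S. (w' @ w, []) \<in> pres_rel S R"
  using assms
proof (induction w)
  case Nil
  have "([] @ [], []) \<in> pres_rel S R" "[] \<in> words S"
    by (auto simp: words_def intro!: pres_rel.refl)
  then show ?case by blast
next
  case (Cons l w)
  obtain x b where l: "l = (x, b)" by (cases l)
  have x: "x \<in> S" and w: "w \<in> words S"
    using Cons.prems by (auto simp: words_def l)
  obtain w' where w': "w' \<in> words S" "(w' @ w, []) \<in> pres_rel S R"
    using Cons.IH[OF w] by blast
  have "([(x, \<not> b), (x, b)], []) \<in> pres_rel S R"
    using pres_rel.cancel[OF x, of "\<not> b"] by simp
  then have "(w' @ ([(x, \<not> b), (x, b)] @ w), w' @ ([] @ w)) \<in> pres_rel S R"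
    by (intro pres_rel.append pres_rel.refl w w')
  then have "((w' @ [(x, \<not> b)]) @ (l # w), []) \<in> pres_rel S R"
    using pres_rel.trans[OF _ w'(2)] by (simp add: l)
  moreover have "w' @ [(x, \<not> b)] \<in> words S"
    using w' x by (auto simp: words_def)
  ultimately show ?case by blast
qed

lemma group_pres_group: "group (pres_group S R)"
proof (rule groupI)
  have app: "u @ v \<in> words S" if "u \<in> words S" "v \<in> words S" for u v
    using that by (auto simp: words_def)
  have nil: "[] \<in> words S" by (simp add: words_def)
  let ?G = "pres_group S R"
  show "\<one>\<^bsub>?G\<^esub> \<in> carrier ?G"
    by (auto simp: carrier_pres_group one_pres_group nil)
  show "x \<otimes>\<^bsub>?G\<^esub> y \<in> carrier ?G" if "x \<in> carrier ?G" "y \<in> carrier ?G" for x y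
    using that by (auto simp: carrier_pres_group mult_pres_class app)
  show "x \<otimes>\<^bsub>?G\<^esub> y \<otimes>\<^bsub>?G\<^esub> z = x \<otimes>\<^bsub>?G\<^esub> (y \<otimes>\<^bsub>?G\<^esub> z)"
    if "x \<in> carrier ?G" "y \<in> carrier ?G" "z \<in> carrier ?G" for x y z
    using that by (auto simp: carrier_pres_group mult_pres_class app)
  show "\<one>\<^bsub>?G\<^esub> \<otimes>\<^bsub>?G\<^esub> x = x" if "x \<in> carrier ?G" for x
    using that by (auto simp: carrier_pres_group one_pres_group mult_pres_class nil)
  show "\<exists>y \<in> carrier ?G. y \<otimes>\<^bsub>?G\<^esub> x = \<one>\<^bsub>?G\<^esub>" if x: "x \<in> carrier ?G" for x
  proof -
    obtain w where w: "w \<in> words S" "x = pres_class S R w"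
      using x by (auto simp: carrier_pres_group)
    obtain w' where "w' \<in> words S" "(w' @ w, []) \<in> pres_rel S R"
      using pres_rel_left_inverse[OF w(1)] by blast
    then show ?thesis
      using w by (auto simp: carrier_pres_group one_pres_group mult_pres_class
          intro!: bexI[of _ w'] pres_class_eqI)
  qed
qed

section \<open>The groups \<open>G\<^sub>m\<^sup>2\<close> and \<open>G\<^sub>n\<^sub>,\<^sub>d\<^sup>2\<close>\<close>

text \<open>Generators \<open>a\<^sub>i\<^sub>j\<close> are labelled by the unordered pair \<open>{i, j}\<close>, so that \<open>a i j = a j i\<close>
  as letters.\<close>

datatype gen = Pair "nat set" | Point nat

definition a :: "nat \<Rightarrow> nat \<Rightarrow> gen \<times> bool" where
  "a i j = (Pair {i, j}, True)"

definition \<tau> :: "nat \<Rightarrow> gen \<times> bool" where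
  "\<tau> i = (Point i, True)"

definition G2_gens :: "nat \<Rightarrow> gen set" where
  "G2_gens m = {Pair {i, j} | i j. i \<in> {1..m} \<and> j \<in> {1..m} \<and> i < j}"

definition G2_rels :: "nat \<Rightarrow> (gen word \<times> gen word) set" where
  "G2_rels m =
     {([a i j, a i j], []) | i j. {i, j} \<subseteq> {1..m} \<and> i \<noteq> j}
   \<union> {([a i j, a k l], [a k l, a i j]) | i j k l. {i, j, k, l} \<subseteq> {1..m} \<and> distinct [i, j, k, l]}
   \<union> {([a i j, a i k, a j k], [a j k, a i k, a i j]) | i j k.
        {i, j, k} \<subseteq> {1..m} \<and> distinct [i, j, k]}"

definition G2 :: "nat \<Rightarrow> gen word set monoid" where
  "G2 m = pres_group (G2_gens m) (G2_rels m)"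

definition G2d_gens :: "nat \<Rightarrow> gen set" where
  "G2d_gens n = G2_gens n \<union> Point ` {1..n}"

definition G2d_rels :: "nat \<Rightarrow> (gen word \<times> gen word) set" where
  "G2d_rels n = G2_rels n
   \<union> {([\<tau> i, \<tau> i], []) | i. i \<in> {1..n}}
   \<union> {([\<tau> i, \<tau> j], [\<tau> j, \<tau> i]) | i j. {i, j} \<subseteq> {1..n}}
   \<union> {([\<tau> i, \<tau> j, a i j, \<tau> j, \<tau> i], [a i j]) | i j. {i, j} \<subseteq> {1..n} \<and> i \<noteq> j}
   \<union> {([a i j, \<tau> k], [\<tau> k, a i j]) | i j k. {i, j, k} \<subseteq> {1..n} \<and> distinct [i, j, k]}"

definition G2d :: "nat \<Rightarrow> gen word set monoid" where
  "G2d n = pres_group (G2d_gens n) (G2d_rels n)"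

definition G2_elem :: "nat \<Rightarrow> gen word \<Rightarrow> gen word set" where
  "G2_elem m w = pres_class (G2_gens m) (G2_rels m) w"

definition G2d_elem :: "nat \<Rightarrow> gen word \<Rightarrow> gen word set" where
  "G2d_elem n w = pres_class (G2d_gens n) (G2d_rels n) w"

end

theory Submission
  imports Defs
begin

text \<open>By von Dyck's theorem it suffices that the images of the generators satisfy the relations of
  \<open>G\<^sub>n\<^sub>+\<^sub>1\<^sup>2\<close>. Relations avoiding the index \<open>n + 1\<close> are relations of \<open>G\<^sub>n\<^sub>,\<^sub>d\<^sup>2\<close>; the relations (1) and (2)
  involving it become \<open>\<tau>\<^sub>i\<^sup>2 = 1\<close> and \<open>a\<^sub>i\<^sub>j \<tau>\<^sub>k = \<tau>\<^sub>k a\<^sub>i\<^sub>j\<close>. The triangle relation (3) becomes, according to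
  the position of \<open>n + 1\<close>, one of \<open>\<tau>\<^sub>i \<tau>\<^sub>j a\<^sub>i\<^sub>j = a\<^sub>i\<^sub>j \<tau>\<^sub>j \<tau>\<^sub>i\<close>, \<open>\<tau>\<^sub>i a\<^sub>i\<^sub>j \<tau>\<^sub>j = \<tau>\<^sub>j a\<^sub>i\<^sub>j \<tau>\<^sub>i\<close> and
  \<open>a\<^sub>i\<^sub>j \<tau>\<^sub>i \<tau>\<^sub>j = \<tau>\<^sub>j \<tau>\<^sub>i a\<^sub>i\<^sub>j\<close>. As \<open>\<tau>\<^sub>i\<close> and \<open>\<tau>\<^sub>j\<close> are commuting involutions, each of these says that
  \<open>\<tau>\<^sub>i \<tau>\<^sub>j\<close> commutes with \<open>a\<^sub>i\<^sub>j\<close>, which is relation (6).\<close>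

section \<open>Evaluation of words in a group and von Dyck's theorem\<close>

primrec eval_word :: "('g, 'b) monoid_scheme \<Rightarrow> ('a \<Rightarrow> 'g) \<Rightarrow> 'a word \<Rightarrow> 'g" where
  "eval_word G f [] = \<one>\<^bsub>G\<^esub>"
| "eval_word G f (l # w) =
     (if snd l then f (fst l) else inv\<^bsub>G\<^esub> f (fst l)) \<otimes>\<^bsub>G\<^esub> eval_word G f w"

lemma words_simps [simp]:
  "[] \<in> words S"
  "l # w \<in> words S \<longleftrightarrow> fst l \<in> S \<and> w \<in> words S"
  by (cases l; auto simp: words_def)+

context group
begin

lemma eval_word_closed:
  assumes "\<And>x. x \<in> S \<Longrightarrow> f x \<in> carrier G" "w \<in> words S"
  shows "eval_word G f w \<in> carrier G"
  using assms(2) by (induction w) (auto simp: assms(1))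

lemma eval_word_append:
  assumes f: "\<And>x. x \<in> S \<Longrightarrow> f x \<in> carrier G" and "u \<in> words S" "v \<in> words S"
  shows "eval_word G f (u @ v) = eval_word G f u \<otimes> eval_word G f v"
  using assms(2)
proof (induction u)
  case Nil
  then show ?case using eval_word_closed[OF f assms(3)] by simp
next
  case (Cons l u)
  then show ?case
    using eval_word_closed[OF f assms(3)] eval_word_closed[OF f, where w = u] f
    by (auto simp: m_assoc)
qed

text \<open>\<open>pres_rel S R\<close> is the least congruence on \<open>words S\<close> that
  contains the relations in \<open>R\<close> and the free cancellations; having equal values in
  \<open>G\<close> is itself a congruence with these properties.\<close>

lemma eval_word_pres_rel:
  assumes f: "\<And>x. x \<in> S \<Longrightarrow> f x \<in> carrier G"
    and R: "\<And>u v. (u, v) \<in> R \<Longrightarrow> u \<in> words S \<Longrightarrow> v \<in> words S \<Longrightarrow> eval_word G f u = eval_word G f v"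
    and "(u, v) \<in> pres_rel S R"
  shows "eval_word G f u = eval_word G f v"
  using assms(3)
proof induction
  case (append u u' v v')
  then show ?case
    using append.hyps[THEN pres_rel_words] by (simp add: eval_word_append[OF f])
next
  case (cancel x b)
  then show ?case by (cases b) (auto simp: f)
qed (auto simp: R)

text \<open>The universal property of a presentation: evaluation is constant on classes by
  \<open>eval_word_pres_rel\<close> and multiplicative by \<open>eval_word_append\<close>, so it
  descends to the quotient.\<close>

lemma von_Dyck:
  assumes f: "\<And>x. x \<in> S \<Longrightarrow> f x \<in> carrier G"
    and R: "\<And>u v. (u, v) \<in> R \<Longrightarrow> u \<in> words S \<Longrightarrow> v \<in> words S \<Longrightarrow> eval_word G f u = eval_word G f v"
  obtains \<psi> where "group_hom (pres_group S R) G \<psi>"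
    "\<And>w. w \<in> words S \<Longrightarrow> \<psi> (pres_class S R w) = eval_word G f w"
proof -
  \<comment> \<open>A class is evaluated at an arbitrarily chosen representative; the next step
    shows that the choice does not matter.\<close>
  define \<psi> where "\<psi> X = eval_word G f (SOME w. w \<in> words S \<and> X = pres_class S R w)" for X
  have \<psi>: "\<psi> (pres_class S R w) = eval_word G f w" if w: "w \<in> words S" for w
  proof -
    let ?v = "SOME v. v \<in> words S \<and> pres_class S R w = pres_class S R v"
    have "?v \<in> words S \<and> pres_class S R w = pres_class S R ?v"
      by (rule someI[of _ w]) (simp add: w)
    then have "(w, ?v) \<in> pres_rel S R"
      using pres_class_eq_iff[OF w] by blast
    from eval_word_pres_rel[OF f R this] show ?thesis
      by (simp add: \<psi>_def)
  qed
  have "\<psi> \<in> hom (pres_group S R) G"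
  proof (rule homI)
    show "\<psi> X \<in> carrier G" if "X \<in> carrier (pres_group S R)" for X
      using that by (auto simp: carrier_pres_group \<psi> intro: eval_word_closed[OF f])
    show "\<psi> (X \<otimes>\<^bsub>pres_group S R\<^esub> Y) = \<psi> X \<otimes> \<psi> Y"
      if XY: "X \<in> carrier (pres_group S R)" "Y \<in> carrier (pres_group S R)" for X Y
    proof -
      obtain u v where uv: "u \<in> words S" "v \<in> words S" "X = pres_class S R u" "Y = pres_class S R v"
        using XY by (auto simp: carrier_pres_group)
      then have "u @ v \<in> words S" by (simp add: words_def)
      then show ?thesis
        using uv by (simp add: mult_pres_class \<psi> eval_word_append[OF f])
    qed
  qed
  then have "group_hom (pres_group S R) G \<psi>"
    by (simp add: group_hom_def group_hom_axioms_def group_pres_group is_group)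
  with \<psi> show thesis using that by blast
qed

text \<open>For p = \<tau>_i, q = \<tau>_j and x = a_ij these are the images of the triangle
  relation in which \<open>n + 1\<close> stands first, last and in the middle, respectively.\<close>

lemma commuting_involutions_triangle:
  assumes c: "p \<in> carrier G" "q \<in> carrier G" "x \<in> carrier G"
    and p: "p \<otimes> p = \<one>" and q: "q \<otimes> q = \<one>" and pq: "p \<otimes> q = q \<otimes> p"
    and conj: "p \<otimes> (q \<otimes> (x \<otimes> (q \<otimes> p))) = x"
  shows "p \<otimes> (q \<otimes> x) = x \<otimes> (q \<otimes> p)" "x \<otimes> (p \<otimes> q) = q \<otimes> (p \<otimes> x)"
    "p \<otimes> (x \<otimes> q) = q \<otimes> (x \<otimes> p)"
proof -
  \<comment> \<open>The laws are restated with a tail y, to act inside products bracketed to the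
    right.\<close>
  have pp: "p \<otimes> (p \<otimes> y) = y" and qq: "q \<otimes> (q \<otimes> y) = y" and pqy: "p \<otimes> (q \<otimes> y) = q \<otimes> (p \<otimes> y)"
    if "y \<in> carrier G" for y
    using that c p q pq by (simp_all flip: m_assoc)
  \<comment> \<open>The trivial product q p p q is put in front, so that the left-hand side of
    \<open>conj\<close> appears as a tail.\<close>
  have "x \<otimes> (q \<otimes> p) = q \<otimes> (p \<otimes> (p \<otimes> (q \<otimes> (x \<otimes> (q \<otimes> p)))))"
    using c by (simp add: pp qq)
  then have *: "x \<otimes> (q \<otimes> p) = q \<otimes> (p \<otimes> x)"
    by (simp add: conj)
  show "p \<otimes> (q \<otimes> x) = x \<otimes> (q \<otimes> p)" "x \<otimes> (p \<otimes> q) = q \<otimes> (p \<otimes> x)"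
    using c by (simp_all add: * pq pqy)
  \<comment> \<open>Inserting p p = 1 at the right end creates the factor x q p, to which
    \<open>*\<close> applies.\<close>
  have "p \<otimes> (x \<otimes> q) = p \<otimes> ((x \<otimes> (q \<otimes> p)) \<otimes> p)"
    using c by (simp add: m_assoc p)
  also have "\<dots> = p \<otimes> (q \<otimes> (p \<otimes> (x \<otimes> p)))"
    unfolding * using c by (simp add: m_assoc)
  also have "\<dots> = q \<otimes> (x \<otimes> p)"
    using c by (simp add: pqy pp)
  finally show "p \<otimes> (x \<otimes> q) = q \<otimes> (x \<otimes> p)" .
qed

end

section \<open>The images of the generators, and the defining relations of \<open>G2d n\<close> as
  equations in that group\<close>

lemma pres_class_Cons:
  assumes "l # w \<in> words S"
  shows "pres_class S R (l # w) = pres_class S R [l] \<otimes>\<^bsub>pres_group S R\<^esub> pres_class S R w"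
  using mult_pres_class[of "[l]" S w R] assms by simp

lemma Pair_in_G2_gens:
  assumes "i \<in> {1..m}" "j \<in> {1..m}" "i \<noteq> j"
  shows "Pair {i, j} \<in> G2_gens m"
proof -
  have *: "Pair {i, j} \<in> G2_gens m" if "i \<in> {1..m}" "j \<in> {1..m}" "i < j" for i j
    using that unfolding G2_gens_def by blast
  show ?thesis
    using *[of i j] *[of j i] assms by (cases "i < j") (simp_all add: insert_commute)
qed

text \<open>If \<open>n + 1\<close> is the larger index of \<open>e\<close>, then \<open>Min e\<close> is the other one; the value at points is irrelevant,
  since they are not generators of \<open>G\<^sub>n\<^sub>+\<^sub>1\<^sup>2\<close>.\<close>
definition \<psi>_gen :: "nat \<Rightarrow> gen \<Rightarrow> gen word set" where
  "\<psi>_gen n g = (case g of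
     Pair e \<Rightarrow> if n + 1 \<in> e then G2d_elem n [\<tau> (Min e)] else G2d_elem n [(Pair e, True)]
   | Point i \<Rightarrow> G2d_elem n [\<tau> i])"

lemma \<psi>_gen_Pair:
  assumes "i \<in> {1..n + 1}" "j \<in> {1..n + 1}"
  shows "\<psi>_gen n (Pair {i, j}) =
    (if n + 1 \<notin> {i, j} then G2d_elem n [a i j]
     else if j = n + 1 then G2d_elem n [\<tau> i] else G2d_elem n [\<tau> j])"
  using assms by (simp add: \<psi>_gen_def a_def)

context
  fixes n :: nat
begin

interpretation D: group "G2d n"
  unfolding G2d_def by (rule group_pres_group)

abbreviation (input) "A i j \<equiv> G2d_elem n [a i j]"
abbreviation (input) "T i \<equiv> G2d_elem n [\<tau> i]"

lemma a_gens: "i \<in> {1..n} \<Longrightarrow> j \<in> {1..n} \<Longrightarrow> i \<noteq> j \<Longrightarrow> fst (a i j) \<in> G2d_gens n"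
  using Pair_in_G2_gens by (simp add: a_def G2d_gens_def)

lemma \<tau>_gens: "i \<in> {1..n} \<Longrightarrow> fst (\<tau> i) \<in> G2d_gens n"
  by (simp add: \<tau>_def G2d_gens_def)

lemma G2d_elem_closed: "w \<in> words (G2d_gens n) \<Longrightarrow> G2d_elem n w \<in> carrier (G2d n)"
  by (simp add: G2d_elem_def G2d_def carrier_pres_group)

lemma A_closed [simp]: "i \<in> {1..n} \<Longrightarrow> j \<in> {1..n} \<Longrightarrow> i \<noteq> j \<Longrightarrow> A i j \<in> carrier (G2d n)"
  by (rule G2d_elem_closed) (simp add: a_gens)

lemma T_closed [simp]: "i \<in> {1..n} \<Longrightarrow> T i \<in> carrier (G2d n)"
  by (rule G2d_elem_closed) (simp add: \<tau>_gens)

lemma G2d_elem_Nil: "G2d_elem n [] = \<one>\<^bsub>G2d n\<^esub>"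
  by (simp add: G2d_elem_def G2d_def one_pres_group)

text \<open>A second letter is required because on one-letter words the equation would only split
  off the empty word, and as a rewrite rule it would never stop.\<close>

lemma G2d_elem_Cons:
  "l # k # w \<in> words (G2d_gens n) \<Longrightarrow>
    G2d_elem n (l # k # w) = G2d_elem n [l] \<otimes>\<^bsub>G2d n\<^esub> G2d_elem n (k # w)"
  unfolding G2d_elem_def G2d_def by (rule pres_class_Cons)

lemma G2d_elem_rel:
  "(u, v) \<in> G2d_rels n \<Longrightarrow> u \<in> words (G2d_gens n) \<Longrightarrow> v \<in> words (G2d_gens n) \<Longrightarrow>
    G2d_elem n u = G2d_elem n v"
  unfolding G2d_elem_def by (intro pres_class_eqI pres_rel.rel)

lemmas G2d_word_simps = G2d_elem_Nil G2d_elem_Cons a_gens \<tau>_gens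

lemma A_square:
  assumes "i \<in> {1..n}" "j \<in> {1..n}" "i \<noteq> j"
  shows "A i j \<otimes>\<^bsub>G2d n\<^esub> A i j = \<one>\<^bsub>G2d n\<^esub>"
proof -
  have "([a i j, a i j], []) \<in> G2d_rels n"
    using assms unfolding G2d_rels_def G2_rels_def by blast
  from G2d_elem_rel[OF this] assms show ?thesis by (simp add: G2d_word_simps)
qed

lemma A_A_commute:
  assumes "{i, j, k, l} \<subseteq> {1..n}" "distinct [i, j, k, l]"
  shows "A i j \<otimes>\<^bsub>G2d n\<^esub> A k l = A k l \<otimes>\<^bsub>G2d n\<^esub> A i j"
proof -
  have "([a i j, a k l], [a k l, a i j]) \<in> G2_rels n"
    unfolding G2_rels_def
    by (rule UnI1, rule UnI2, rule CollectI, rule exI[of _ i], rule exI[of _ j], rule exI[of _ k],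
        rule exI[of _ l]) (use assms in simp)
  then have "([a i j, a k l], [a k l, a i j]) \<in> G2d_rels n"
    by (simp add: G2d_rels_def)
  from G2d_elem_rel[OF this] assms show ?thesis by (simp add: G2d_word_simps)
qed

lemma A_triangle:
  assumes "{i, j, k} \<subseteq> {1..n}" "distinct [i, j, k]"
  shows "A i j \<otimes>\<^bsub>G2d n\<^esub> (A i k \<otimes>\<^bsub>G2d n\<^esub> A j k) = A j k \<otimes>\<^bsub>G2d n\<^esub> (A i k \<otimes>\<^bsub>G2d n\<^esub> A i j)"
proof -
  have "([a i j, a i k, a j k], [a j k, a i k, a i j]) \<in> G2d_rels n"
    using assms unfolding G2d_rels_def G2_rels_def by blast
  from G2d_elem_rel[OF this] assms show ?thesis by (simp add: G2d_word_simps)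
qed

lemma T_square:
  assumes "i \<in> {1..n}"
  shows "T i \<otimes>\<^bsub>G2d n\<^esub> T i = \<one>\<^bsub>G2d n\<^esub>"
proof -
  have "([\<tau> i, \<tau> i], []) \<in> G2d_rels n"
    using assms unfolding G2d_rels_def by blast
  from G2d_elem_rel[OF this] assms show ?thesis by (simp add: G2d_word_simps)
qed

lemma T_T_commute:
  assumes "i \<in> {1..n}" "j \<in> {1..n}"
  shows "T i \<otimes>\<^bsub>G2d n\<^esub> T j = T j \<otimes>\<^bsub>G2d n\<^esub> T i"
proof -
  have "([\<tau> i, \<tau> j], [\<tau> j, \<tau> i]) \<in> G2d_rels n"
    using assms unfolding G2d_rels_def by blast
  from G2d_elem_rel[OF this] assms show ?thesis by (simp add: G2d_word_simps)
qed

lemma A_T_commute: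
  assumes "{i, j, k} \<subseteq> {1..n}" "distinct [i, j, k]"
  shows "A i j \<otimes>\<^bsub>G2d n\<^esub> T k = T k \<otimes>\<^bsub>G2d n\<^esub> A i j"
proof -
  have "([a i j, \<tau> k], [\<tau> k, a i j]) \<in> G2d_rels n"
    using assms unfolding G2d_rels_def by blast
  from G2d_elem_rel[OF this] assms show ?thesis by (simp add: G2d_word_simps)
qed

lemma T_T_conj_A:
  assumes "i \<in> {1..n}" "j \<in> {1..n}" "i \<noteq> j"
  shows "T i \<otimes>\<^bsub>G2d n\<^esub> (T j \<otimes>\<^bsub>G2d n\<^esub> (A i j \<otimes>\<^bsub>G2d n\<^esub> (T j \<otimes>\<^bsub>G2d n\<^esub> T i))) = A i j"
proof -
  have "([\<tau> i, \<tau> j, a i j, \<tau> j, \<tau> i], [a i j]) \<in> G2d_rels n"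
    unfolding G2d_rels_def by (rule UnI1, rule UnI2) (use assms in blast)
  from G2d_elem_rel[OF this] assms show ?thesis by (simp add: G2d_word_simps)
qed

text \<open>Relation (6) supplies the hypothesis \<open>conj\<close> for the involutions
  \<open>T i\<close>, \<open>T j\<close> and the element \<open>A i j\<close>.\<close>

lemmas T_T_A_triangle =
  D.commuting_involutions_triangle[OF T_closed T_closed A_closed T_square T_square T_T_commute T_T_conj_A]

section \<open>The relations of \<open>G2 (n + 1)\<close> for the images\<close>

lemma \<psi>_gen_values:
  assumes "i \<in> {1..n}"
  shows "j \<in> {1..n} \<Longrightarrow> \<psi>_gen n (Pair {i, j}) = A i j"
    "\<psi>_gen n (Pair {i, n + 1}) = T i" "\<psi>_gen n (Pair {n + 1, i}) = T i"
  using assms by (simp_all add: \<psi>_gen_Pair)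

lemma index_cases: "i \<in> {1..n + 1} \<Longrightarrow> i \<in> {1..n} \<or> i = n + 1"
  by auto

lemma \<psi>_gen_closed:
  assumes "g \<in> G2_gens (n + 1)"
  shows "\<psi>_gen n g \<in> carrier (G2d n)"
proof -
  obtain i j where g: "g = Pair {i, j}" "i \<in> {1..n + 1}" "j \<in> {1..n + 1}" "i < j"
    using assms unfolding G2_gens_def by blast
  \<comment> \<open>The smaller index is never \<open>n + 1\<close>, so only j has to be split into
    cases.\<close>
  then have "i \<in> {1..n}" by simp
  then show ?thesis
    using g(1,4) index_cases[OF g(3)] by (elim disjE) (simp_all only: \<psi>_gen_values A_closed T_closed less_imp_neq not_False_eq_True)
qed

lemma \<psi>_gen_square:
  assumes "i \<in> {1..n + 1}" "j \<in> {1..n + 1}" "i \<noteq> j"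
  shows "\<psi>_gen n (Pair {i, j}) \<otimes>\<^bsub>G2d n\<^esub> \<psi>_gen n (Pair {i, j}) = \<one>\<^bsub>G2d n\<^esub>"
proof -
  consider "i \<in> {1..n}" "j \<in> {1..n}" | "i = n + 1" "j \<in> {1..n}" | "i \<in> {1..n}" "j = n + 1"
    using assms index_cases by metis
  then show ?thesis
    by cases (simp_all only: \<psi>_gen_values A_square T_square assms not_False_eq_True)
qed

lemma \<psi>_gen_commute:
  assumes "{i, j, k, l} \<subseteq> {1..n + 1}" "distinct [i, j, k, l]"
  shows "\<psi>_gen n (Pair {i, j}) \<otimes>\<^bsub>G2d n\<^esub> \<psi>_gen n (Pair {k, l}) =
    \<psi>_gen n (Pair {k, l}) \<otimes>\<^bsub>G2d n\<^esub> \<psi>_gen n (Pair {i, j})"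
proof -
  have le: "i \<in> {1..n + 1}" "j \<in> {1..n + 1}" "k \<in> {1..n + 1}" "l \<in> {1..n + 1}"
    using assms by simp_all
  have ne: "i \<noteq> j" "i \<noteq> k" "i \<noteq> l" "j \<noteq> k" "j \<noteq> l" "k \<noteq> l"
    using assms by simp_all
  \<comment> \<open>Distinct indices: at most one equals \<open>n + 1\<close>. If one does, relation
    (7) for the other three gives the claim.\<close>
  consider "i \<in> {1..n}" "j \<in> {1..n}" "k \<in> {1..n}" "l \<in> {1..n}"
    | "i = n + 1" "j \<in> {1..n}" "k \<in> {1..n}" "l \<in> {1..n}"
    | "i \<in> {1..n}" "j = n + 1" "k \<in> {1..n}" "l \<in> {1..n}"
    | "i \<in> {1..n}" "j \<in> {1..n}" "k = n + 1" "l \<in> {1..n}"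
    | "i \<in> {1..n}" "j \<in> {1..n}" "k \<in> {1..n}" "l = n + 1"
    using le ne index_cases by metis
  then show ?thesis
  proof cases
    case 1
    then show ?thesis using A_A_commute[of i j k l] assms(2) by (simp add: \<psi>_gen_values)
  next
    case 2
    then show ?thesis using A_T_commute[of k l j] ne by (simp add: \<psi>_gen_values[simplified])
  next
    case 3
    then show ?thesis using A_T_commute[of k l i] ne by (simp add: \<psi>_gen_values[simplified])
  next
    case 4
    then show ?thesis using A_T_commute[of i j l] ne by (simp add: \<psi>_gen_values[simplified])
  next
    case 5
    then show ?thesis using A_T_commute[of i j k] ne by (simp add: \<psi>_gen_values[simplified])
  qed
qed

text \<open>Without the index \<open>n + 1\<close> this is relation (3). Otherwise
  \<open>n + 1\<close> is exactly one of i, j, k, which selects the first, third or second equation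
  of \<open>T_T_A_triangle\<close>.\<close>

lemma \<psi>_gen_triangle:
  assumes "{i, j, k} \<subseteq> {1..n + 1}" "distinct [i, j, k]"
  shows "\<psi>_gen n (Pair {i, j}) \<otimes>\<^bsub>G2d n\<^esub> (\<psi>_gen n (Pair {i, k}) \<otimes>\<^bsub>G2d n\<^esub> \<psi>_gen n (Pair {j, k})) =
    \<psi>_gen n (Pair {j, k}) \<otimes>\<^bsub>G2d n\<^esub> (\<psi>_gen n (Pair {i, k}) \<otimes>\<^bsub>G2d n\<^esub> \<psi>_gen n (Pair {i, j}))"
proof -
  have le: "i \<in> {1..n + 1}" "j \<in> {1..n + 1}" "k \<in> {1..n + 1}"
    using assms by simp_all
  have ne: "i \<noteq> j" "i \<noteq> k" "j \<noteq> k"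
    using assms by simp_all
  consider "i \<in> {1..n}" "j \<in> {1..n}" "k \<in> {1..n}"
    | "i = n + 1" "j \<in> {1..n}" "k \<in> {1..n}"
    | "i \<in> {1..n}" "j = n + 1" "k \<in> {1..n}"
    | "i \<in> {1..n}" "j \<in> {1..n}" "k = n + 1"
    using le ne index_cases by metis
  then show ?thesis
  proof cases
    case 1
    then show ?thesis using A_triangle[of i j k] assms(2) by (simp add: \<psi>_gen_values)
  next
    case 2
    then show ?thesis using ne by (simp only: \<psi>_gen_values T_T_A_triangle(1)[of j k] not_False_eq_True)
  next
    case 3
    then show ?thesis using ne by (simp only: \<psi>_gen_values T_T_A_triangle(3)[of i k] not_False_eq_True)
  next
    case 4
    then show ?thesis using ne by (simp only: \<psi>_gen_values T_T_A_triangle(2)[of i j] not_False_eq_True)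
  qed
qed

lemma \<psi>_gen_rels:
  assumes "(u, v) \<in> G2_rels (n + 1)"
  shows "eval_word (G2d n) (\<psi>_gen n) u = eval_word (G2d n) (\<psi>_gen n) v"
proof -
  have c: "\<psi>_gen n (Pair {i, j}) \<in> carrier (G2d n)"
    if "i \<in> {1..n + 1}" "j \<in> {1..n + 1}" "i \<noteq> j" for i j
    using that by (intro \<psi>_gen_closed Pair_in_G2_gens)
  show ?thesis
    using assms unfolding G2_rels_def
  proof (elim UnE CollectE exE conjE Pair_inject)
    fix i j
    assume "u = [a i j, a i j]" "v = []" "{i, j} \<subseteq> {1..n + 1}" "i \<noteq> j"
    then show ?thesis using \<psi>_gen_square[of i j] c[of i j] by (simp add: a_def)
  next
    fix i j k l
    assume "u = [a i j, a k l]" "v = [a k l, a i j]"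
      "{i, j, k, l} \<subseteq> {1..n + 1}" "distinct [i, j, k, l]"
    then show ?thesis
      using \<psi>_gen_commute[of i j k l] c[of i j] c[of k l] by (simp add: a_def)
  next
    fix i j k
    assume "u = [a i j, a i k, a j k]" "v = [a j k, a i k, a i j]"
      "{i, j, k} \<subseteq> {1..n + 1}" "distinct [i, j, k]"
    then show ?thesis
      using \<psi>_gen_triangle[of i j k] c[of i j] c[of i k] c[of j k] by (simp add: a_def)
  qed
qed

end

theorem lemma4p1:
  fixes n :: nat
  assumes "n \<ge> 1"
  shows "\<exists>\<psi>. group_hom (G2 (n + 1)) (G2d n) \<psi> \<and>
    (\<forall>i \<in> {1..n + 1}. \<forall>j \<in> {1..n + 1}. i \<noteq> j \<longrightarrow>
      \<psi> (G2_elem (n + 1) [a i j]) =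
        (if n + 1 \<notin> {i, j} then G2d_elem n [a i j]
         else if j = n + 1 then G2d_elem n [\<tau> i]
         else G2d_elem n [\<tau> j]))"
proof -
  interpret D: group "G2d n"
    unfolding G2d_def by (rule group_pres_group)
  obtain \<psi> where hom: "group_hom (G2 (n + 1)) (G2d n) \<psi>"
    and \<psi>: "\<And>w. w \<in> words (G2_gens (n + 1)) \<Longrightarrow>
      \<psi> (G2_elem (n + 1) w) = eval_word (G2d n) (\<psi>_gen n) w"
    unfolding G2_def G2_elem_def by (rule D.von_Dyck[OF \<psi>_gen_closed \<psi>_gen_rels]) blast+
  have "\<psi> (G2_elem (n + 1) [a i j]) = \<psi>_gen n (Pair {i, j})"
    if "i \<in> {1..n + 1}" "j \<in> {1..n + 1}" "i \<noteq> j" for i j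
    using Pair_in_G2_gens[OF that] \<psi>_gen_closed \<psi>[of "[a i j]"] by (simp add: a_def)
  then show ?thesis
    using hom \<psi>_gen_Pair by (intro exI[of _ \<psi>]) simp
qed

end
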